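(* Let $n\ge 1$ be arbitrary and let $T_n\in\mathcal{T}_n$. (a) For the hard-core model with $\boldsymbol{\lambda}=(1,\lambda)$ for arbitrary $\lambda>0$, we have $$Z^{\boldsymbol{\lambda}}(P_n,H_{\rm ind})\le Z^{\boldsymbol{\lambda}}(T_n,H_{\rm ind})\le Z^{\boldsymbol{\lambda}}(S_n,H_{\rm ind}).$$ (b) For the $k$-state Widom-Rowlinson model ($k\ge 1$) with $\boldsymbol{\lambda}=(1,\lambda_1,\ldots,\lambda_k)$ for arbitrary $\lambda_i>0$, we have $$Z^{\boldsymbol{\lambda}}(P_n,H_{{\rm WR}(k)})\le Z^{\boldsymbol{\lambda}}(T_n,H_{{\rm WR}(k)})\le Z^{\boldsymbol{\lambda}}(S_n,H_{{\rm WR}(k)}).$$ (c) For the capacity $C$ independent set model ($C\ge 1$ an integer) with $\boldsymbol{\lambda}=(1,\lambda,\ldots,\lambda^C)$ for arbitrary $\lambda>0$, we have $$Z^{\boldsymbol{\lambda}}(P_n,H_C)\le Z^{\boldsymbol{\lambda}}(T_n,H_C)\le Z^{\boldsymbol{\lambda}}(S_n,H_C).$$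
   Context: $\mathcal{T}_n$ is the set of all trees on $n$ vertices, $P_n$ is the path on $n$ vertices, and $S_n=K_{1,n-1}$ is the star on $n$ vertices. For a graph $H$ on vertex set $\{v_0,\ldots,v_k\}$ (no multiple edges, possibly with loops) and a simple loopless graph $G$, an $H$-coloring of $G$ is a map $f:V(G)\to V(H)$ such that $f(u)\sim_H f(v)$ whenever $u\sim_G v$; $\mathrm{Hom}(G,H)$ is the set of $H$-colorings of $G$. Given positive real activities $\boldsymbol{\lambda}=(\lambda_0,\ldots,\lambda_k)$, with $\lambda_i$ associated with $v_i$, the partition function is $Z^{\boldsymbol{\lambda}}(G,H)=\sum_{f\in\mathrm{Hom}(G,H)}\prod_{i=0}^k\lambda_i^{|f^{-1}(v_i)|}$. $H_{\rm ind}$ is the graph on two vertices $v_{\rm out},v_{\rm in}$ joined by an edge, with a loop at $v_{\rm out}$ and no loop at $v_{\rm in}$; in (a), $v_{\rm out}$ has activity $1$ and $v_{\rm in}$ has activity $\lambda$. $H_{{\rm WR}(k)}$ is the fully looped star on vertices $v_0,\ldots,v_k$ with center $v_0$: its edges are $v_0v_i$ for $1\le i\le k$ together with a loop at every vertex; in (b), $v_0$ has activity $1$ and $v_i$ has activity $\lambda_i$ for $1\le i\le k$. $H_C$ is the graph on vertex set $\{0,1,\ldots,C\}$ with $a$ and $b$ adjacent (including possibly $a=b$, giving a loop) if and only if $a+b\le C$; in (c), vertex $i$ has activity $\lambda^i$. *)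

theory Defs
  imports Complex_Main "Graph_Theory.Graph_Theory"
begin

text \<open>
  Undirected graphs are symmetric pair digraphs: an edge uv is the pair of arcs (u,v), (v,u), and a
  loop at v is the arc (v,v). The locale \<^locale>\<open>pair_graph\<close> is a finite simple loopless graph.

  The library's \<^const>\<open>tree\<close> forbids every directed cycle, and in a symmetric digraph
  each edge already yields a directed cycle of length 2. The cycles of the underlying undirected
  graph are the directed cycles of length at least 3.
\<close>

definition undirected_tree :: "'a pair_pre_digraph \<Rightarrow> bool" where
  "undirected_tree G \<longleftrightarrow>
     pair_graph G \<and> connected (with_proj G) \<and>
     \<not> (\<exists>p. pre_digraph.cycle (with_proj G) p \<and> 3 \<le> length p)"

definition trees :: "nat \<Rightarrow> 'a pair_pre_digraph set" where
  "trees n = {T. undirected_tree T \<and> card (pverts T) = n}"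

definition path_graph :: "nat \<Rightarrow> nat pair_pre_digraph" where
  "path_graph n = \<lparr> pverts = {..<n}, parcs = {(u, v). u < n \<and> v < n \<and> (v = Suc u \<or> u = Suc v)} \<rparr>"

definition star_graph :: "nat \<Rightarrow> nat pair_pre_digraph" where
  "star_graph n = \<lparr> pverts = {..<n}, parcs = {(u, v). u < n \<and> v < n \<and> u \<noteq> v \<and> (u = 0 \<or> v = 0)} \<rparr>"

text \<open>
  Colorings are taken extensional (\<^term>\<open>undefined\<close> off the vertex set of \<open>G\<close>), so that each map from the
  vertices of \<open>G\<close> to those of \<open>H\<close> is counted exactly once.
\<close>

definition Hom :: "'a pair_pre_digraph \<Rightarrow> 'h pair_pre_digraph \<Rightarrow> ('a \<Rightarrow> 'h) set" where
  "Hom G H = {f \<in> pverts G \<rightarrow>\<^sub>E pverts H. \<forall>(u, v) \<in> parcs G. (f u, f v) \<in> parcs H}"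

definition partition_function ::
    "('h \<Rightarrow> real) \<Rightarrow> 'a pair_pre_digraph \<Rightarrow> 'h pair_pre_digraph \<Rightarrow> real" where
  "partition_function act G H =
     (\<Sum>f \<in> Hom G H. \<Prod>i \<in> pverts H. act i ^ card {u \<in> pverts G. f u = i})"

text \<open>Vertex 0 is the looped vertex ``out'', vertex 1 is ``in''.\<close>

definition H_ind :: "nat pair_pre_digraph" where
  "H_ind = \<lparr> pverts = {0, 1}, parcs = {(0, 0), (0, 1), (1, 0)} \<rparr>"

definition H_WR :: "nat \<Rightarrow> nat pair_pre_digraph" where
  "H_WR k = \<lparr> pverts = {0..k}, parcs = {(i, j). i \<le> k \<and> j \<le> k \<and> (i = j \<or> i = 0 \<or> j = 0)} \<rparr>"

definition H_cap :: "nat \<Rightarrow> nat pair_pre_digraph" where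
  "H_cap C = \<lparr> pverts = {0..C}, parcs = {(a, b). a + b \<le> C} \<rparr>"

end

theory Submission
  imports Defs
begin

text \<open>
  Root a tree at \<open>r\<close> and let \<open>br t i\<close> be the partition function given that \<open>r\<close> has colour \<open>i\<close>, without
  the activity of \<open>r\<close>. In all three models there is a total preorder of the colours for which every
  \<open>br t\<close> is monotone. Suppose \<open>M\<close> is the symmetric nonnegative kernel of a path between two
  vertices \<open>x\<close> and \<open>y\<close> which carry further branches with monotone weights \<open>u\<close> and \<open>v\<close>. Moving the branches
  from \<open>y\<close> to \<open>x\<close> changes the partition function by
  \[ \sum_{i,j} M_{ij} (u_i v_i - u_i v_j) = \frac12 \sum_{i,j} M_{ij} (u_i - u_j)(v_i - v_j) \ge 0. \]
  Applied with long paths in one direction and with single edges in the other, and with an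
  arbitrary monotone weight at the root to make the induction on the tree work, this inequality gives both
  bounds.
\<close>

section \<open>Colourings of rooted trees\<close>

text \<open>\<open>Join t s\<close> attaches the root of \<open>t\<close> as a further child to the root of \<open>s\<close>.\<close>

datatype shape = Leaf | Join shape shape

primrec edges :: "shape \<Rightarrow> nat" where
  "edges Leaf = 0"
| "edges (Join t s) = Suc (edges t + edges s)"

text \<open>Rooted at an end vertex; the argument counts edges, not vertices.\<close>

primrec path_shape :: "nat \<Rightarrow> shape" where
  "path_shape 0 = Leaf"
| "path_shape (Suc m) = Join (path_shape m) Leaf"

primrec star_shape :: "nat \<Rightarrow> shape" where
  "star_shape 0 = Leaf"
| "star_shape (Suc m) = Join Leaf (star_shape m)"

locale weighted_target =
  fixes H :: "'h pair_pre_digraph" and act :: "'h \<Rightarrow> real"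
  assumes finite_colours: "finite (pverts H)"
    and sym_arcs: "(i, j) \<in> parcs H \<Longrightarrow> (j, i) \<in> parcs H"
    and act_nonneg: "i \<in> pverts H \<Longrightarrow> 0 \<le> act i"
begin

text \<open>The transfer operator of one edge: if \<open>u j\<close> weighs a branch whose root has
  colour \<open>j\<close>, then \<open>K u i\<close> weighs that branch hung below a vertex of
  colour \<open>i\<close>.\<close>

definition K :: "('h \<Rightarrow> real) \<Rightarrow> 'h \<Rightarrow> real" where
  "K u i = (\<Sum>j\<in>pverts H. if (i, j) \<in> parcs H then act j * u j else 0)"

text \<open>Two branches glued at a common root. The activity of the root, left out of
  \<open>br\<close>, enters here once.\<close>

definition inner :: "('h \<Rightarrow> real) \<Rightarrow> ('h \<Rightarrow> real) \<Rightarrow> real" where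
  "inner u v = (\<Sum>i\<in>pverts H. act i * u i * v i)"

primrec br :: "shape \<Rightarrow> 'h \<Rightarrow> real" where
  "br Leaf = (\<lambda>_. 1)"
| "br (Join t s) = (\<lambda>i. br s i * K (br t) i)"

text \<open>Self-adjointness, from the symmetry of \<open>H\<close>: both sides sum over the colours
  of the two ends of one edge.\<close>

lemma inner_K: "inner (K u) v = inner u (K v)"
proof -
  have "inner (K u) v = (\<Sum>i\<in>pverts H. \<Sum>j\<in>pverts H. if (i, j) \<in> parcs H then act i * act j * u j * v i else 0)"
    unfolding inner_def K_def sum_distrib_left sum_distrib_right
    by (intro sum.cong refl) auto
  also have "\<dots> = (\<Sum>j\<in>pverts H. \<Sum>i\<in>pverts H. if (i, j) \<in> parcs H then act i * act j * u j * v i else 0)"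
    by (rule sum.swap)
  also have "\<dots> = inner u (K v)"
    unfolding inner_def K_def sum_distrib_left sum_distrib_right
    by (intro sum.cong refl) (auto dest: sym_arcs)
  finally show ?thesis .
qed

lemma inner_K_funpow: "inner ((K ^^ m) u) v = inner u ((K ^^ m) v)"
proof (induction m arbitrary: u v)
  case (Suc m)
  then show ?case by (simp add: inner_K funpow_swap1)
qed simp

lemma inner_commute: "inner u v = inner v u"
  by (simp add: inner_def mult.commute mult.left_commute)

lemma br_path_shape: "br (path_shape m) = (K ^^ m) (\<lambda>_. 1)"
  by (induction m) auto

lemma br_star_shape: "br (star_shape m) = (\<lambda>i. K (\<lambda>_. 1) i ^ m)"
  by (induction m) (auto simp: mult.commute)

text \<open>\<open>N i j\<close> is the total activity of the walks with \<open>m\<close> steps from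
  \<open>i\<close> to \<open>j\<close> in \<open>H\<close>, both ends included.\<close>

lemma inner_K_funpow_nonneg_kernel:
  "\<exists>N. (\<forall>i\<in>pverts H. \<forall>j\<in>pverts H. 0 \<le> N i j) \<and>
     (\<forall>u v. inner u ((K ^^ m) v) = (\<Sum>i\<in>pverts H. \<Sum>j\<in>pverts H. N i j * u i * v j))"
proof (induction m)
  case 0
  have "(\<Sum>j\<in>pverts H. (if i = j then act i else 0) * u i * v j) = act i * u i * v i"
    if "i \<in> pverts H" for i and u v :: "'h \<Rightarrow> real"
  proof -
    have "(\<Sum>j\<in>pverts H. (if i = j then act i else 0) * u i * v j) =
        (\<Sum>j\<in>pverts H. if i = j then act i * u i * v j else 0)"
      by (intro sum.cong) auto
    then show ?thesis using that finite_colours by simp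
  qed
  then show ?case
    by (intro exI[of _ "\<lambda>i j. if i = j then act i else 0"]) (simp add: inner_def act_nonneg)
next
  case (Suc m)
  then obtain N where N: "\<And>i j. i \<in> pverts H \<Longrightarrow> j \<in> pverts H \<Longrightarrow> 0 \<le> N i j"
    "\<And>u v. inner u ((K ^^ m) v) = (\<Sum>i\<in>pverts H. \<Sum>j\<in>pverts H. N i j * u i * v j)" by blast
  \<comment> \<open>The walk is prolonged at its first end: \<open>l\<close> is the new first
    colour, adjacent to the old one \<open>i\<close>, whose activity is already part of
    \<open>N i j\<close>.\<close>
  let ?N = "\<lambda>l j. \<Sum>i\<in>pverts H. if (i, l) \<in> parcs H then act l * N i j else 0"
  have "inner u ((K ^^ Suc m) v) = (\<Sum>l\<in>pverts H. \<Sum>j\<in>pverts H. ?N l j * u l * v j)" for u v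
  proof -
    have "inner u ((K ^^ Suc m) v) = inner (K u) ((K ^^ m) v)" by (simp add: inner_K)
    also have "\<dots> = (\<Sum>i\<in>pverts H. \<Sum>j\<in>pverts H. \<Sum>l\<in>pverts H.
        (if (i, l) \<in> parcs H then act l * N i j else 0) * u l * v j)"
      unfolding N(2) K_def sum_distrib_left sum_distrib_right
      by (intro sum.cong refl) (auto simp: ac_simps)
    also have "\<dots> = (\<Sum>i\<in>pverts H. \<Sum>l\<in>pverts H. \<Sum>j\<in>pverts H.
        (if (i, l) \<in> parcs H then act l * N i j else 0) * u l * v j)"
      by (rule sum.cong[OF refl sum.swap])
    also have "\<dots> = (\<Sum>l\<in>pverts H. \<Sum>i\<in>pverts H. \<Sum>j\<in>pverts H.
        (if (i, l) \<in> parcs H then act l * N i j else 0) * u l * v j)"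
      by (rule sum.swap)
    also have "\<dots> = (\<Sum>l\<in>pverts H. \<Sum>j\<in>pverts H. \<Sum>i\<in>pverts H.
        (if (i, l) \<in> parcs H then act l * N i j else 0) * u l * v j)"
      by (rule sum.cong[OF refl sum.swap])
    finally show ?thesis by (simp add: sum_distrib_right)
  qed
  moreover have "0 \<le> ?N l j" if "l \<in> pverts H" "j \<in> pverts H" for l j
    using that N(1) act_nonneg by (intro sum_nonneg) auto
  ultimately show ?case by (intro exI[of _ ?N]) blast
qed

text \<open>Testing the bilinear form on indicator functions recovers the entries of
  \<open>N\<close>, so self-adjointness of \<open>K ^^ m\<close> makes \<open>N\<close>
  symmetric.\<close>

lemma inner_K_funpow_sym_kernel:
  obtains N where "\<And>i j. i \<in> pverts H \<Longrightarrow> j \<in> pverts H \<Longrightarrow> 0 \<le> N i j"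
    and "\<And>i j. i \<in> pverts H \<Longrightarrow> j \<in> pverts H \<Longrightarrow> N i j = N j i"
    and "\<And>u v. inner u ((K ^^ m) v) = (\<Sum>i\<in>pverts H. \<Sum>j\<in>pverts H. N i j * u i * v j)"
proof -
  obtain N where N: "\<And>i j. i \<in> pverts H \<Longrightarrow> j \<in> pverts H \<Longrightarrow> 0 \<le> N i j"
    "\<And>u v. inner u ((K ^^ m) v) = (\<Sum>i\<in>pverts H. \<Sum>j\<in>pverts H. N i j * u i * v j)"
    using inner_K_funpow_nonneg_kernel by blast
  define e :: "'h \<Rightarrow> 'h \<Rightarrow> real" where "e i = (\<lambda>j. if j = i then 1 else 0)" for i
  have eq: "N i j = inner (e i) ((K ^^ m) (e j))" if "i \<in> pverts H" "j \<in> pverts H" for i j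
  proof -
    have "inner (e i) ((K ^^ m) (e j)) = (\<Sum>x\<in>pverts H. if x = i then N x j else 0)"
      unfolding N(2) using that
      by (intro sum.cong refl)
        (simp add: e_def if_distrib[of "\<lambda>y. _ * y"] finite_colours cong: if_cong)
    then show ?thesis using that finite_colours by simp
  qed
  have "N i j = N j i" if "i \<in> pverts H" "j \<in> pverts H" for i j
    using eq[OF that] eq[OF that(2,1)] inner_K_funpow inner_commute by metis
  then show ?thesis using N that by blast
qed

end

section \<open>Monotone branch functions\<close>

text \<open>\<open>R i j\<close> places \<open>i\<close> below \<open>j\<close>.
  \<open>K_mono\<close> says that hanging a branch below a new vertex by an edge keeps its weight
  monotone in the root colour.\<close>

locale ordered_target = weighted_target +
  fixes R :: "'a \<Rightarrow> 'a \<Rightarrow> bool"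
  assumes total: "i \<in> pverts H \<Longrightarrow> j \<in> pverts H \<Longrightarrow> R i j \<or> R j i"
    and K_mono: "\<lbrakk>\<And>i. i \<in> pverts H \<Longrightarrow> 0 \<le> u i;
        \<And>i j. i \<in> pverts H \<Longrightarrow> j \<in> pverts H \<Longrightarrow> R i j \<Longrightarrow> u i \<le> u j;
        i \<in> pverts H; j \<in> pverts H; R i j\<rbrakk> \<Longrightarrow> K u i \<le> K u j"
begin

text \<open>Nonnegativity is included so that products of monotone functions stay monotone.\<close>

definition cone :: "('a \<Rightarrow> real) set" where
  "cone = {u. (\<forall>i\<in>pverts H. 0 \<le> u i) \<and> (\<forall>i\<in>pverts H. \<forall>j\<in>pverts H. R i j \<longrightarrow> u i \<le> u j)}"

lemma one_cone: "(\<lambda>_. 1) \<in> cone"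
  by (simp add: cone_def)

lemma mult_cone: "u \<in> cone \<Longrightarrow> v \<in> cone \<Longrightarrow> (\<lambda>i. u i * v i) \<in> cone"
  by (auto simp: cone_def intro: mult_mono)

lemma K_cone:
  assumes "u \<in> cone"
  shows "K u \<in> cone"
proof -
  have "0 \<le> K u i" for i
    using assms act_nonneg unfolding K_def cone_def by (intro sum_nonneg) auto
  then show ?thesis using assms K_mono[of u] unfolding cone_def by blast
qed

lemma br_cone: "br t \<in> cone"
  by (induction t) (auto intro: one_cone mult_cone K_cone)

text \<open>Any two colours are comparable, so the two differences never have opposite
  signs.\<close>

lemma cone_comonotone:
  assumes "u \<in> cone" "v \<in> cone" "i \<in> pverts H" "j \<in> pverts H"
  shows "0 \<le> (u i - u j) * (v i - v j)"
  using total[OF assms(3,4)] assms by (auto simp: cone_def mult_nonneg_nonneg mult_nonpos_nonpos)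

text \<open>A Chebyshev sum inequality: the branch \<open>v\<close> moves along a path of
  \<open>m\<close> edges to the end that carries \<open>u\<close>.\<close>

lemma shift_le:
  assumes "u \<in> cone" "v \<in> cone"
  shows "inner u ((K ^^ m) v) \<le> inner (\<lambda>i. u i * v i) ((K ^^ m) (\<lambda>_. 1))"
proof -
  obtain N where N: "\<And>i j. i \<in> pverts H \<Longrightarrow> j \<in> pverts H \<Longrightarrow> 0 \<le> N i j"
    "\<And>i j. i \<in> pverts H \<Longrightarrow> j \<in> pverts H \<Longrightarrow> N i j = N j i"
    "\<And>u v. inner u ((K ^^ m) v) = (\<Sum>i\<in>pverts H. \<Sum>j\<in>pverts H. N i j * u i * v j)"
    using inner_K_funpow_sym_kernel by blast
  let ?S = "\<lambda>f. \<Sum>i\<in>pverts H. \<Sum>j\<in>pverts H. N i j * f i j"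
  \<comment> \<open>Symmetry of \<open>N\<close> pairs off the four sums of the expanded product,
    which gives twice the difference of the two sides.\<close>
  have swap: "?S (\<lambda>i j. f j i) = ?S f" for f :: "'a \<Rightarrow> 'a \<Rightarrow> real"
    by (subst sum.swap) (intro sum.cong refl, simp add: N(2))
  have "0 \<le> ?S (\<lambda>i j. (u i - u j) * (v i - v j))"
    using N(1) cone_comonotone[OF assms] by (intro sum_nonneg) auto
  also have "\<dots> = ?S (\<lambda>i j. u i * v i) + ?S (\<lambda>i j. u j * v j)
      - (?S (\<lambda>i j. u i * v j) + ?S (\<lambda>i j. u j * v i))"
    by (simp only: sum.distrib[symmetric] sum_subtractf[symmetric]) (simp add: algebra_simps)
  also have "?S (\<lambda>i j. u j * v j) = ?S (\<lambda>i j. u i * v i)"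
    by (rule swap[of "\<lambda>i j. u i * v i"])
  also have "?S (\<lambda>i j. u j * v i) = ?S (\<lambda>i j. u i * v j)"
    by (rule swap[of "\<lambda>i j. u i * v j"])
  finally show ?thesis unfolding N(3) by (simp add: mult.assoc)
qed

lemma inner_br_Join: "inner w (br (Join t s)) = inner (\<lambda>i. w i * K (br t) i) (br s)"
  by (simp add: inner_def ac_simps)

text \<open>Rerooting across an edge: all that hangs at the root, \<open>w\<close> and
  \<open>v\<close>, becomes one weight seen from the child that carries \<open>u\<close>.\<close>

lemma inner_mult_K: "inner (\<lambda>i. w i * K u i) v = inner (K (\<lambda>i. w i * v i)) u"
proof -
  have "inner (\<lambda>i. w i * K u i) v = inner (\<lambda>i. w i * v i) (K u)"
    by (simp add: inner_def ac_simps)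
  then show ?thesis by (simp add: inner_K)
qed

text \<open>The weight \<open>w\<close> stands for the rest of the tree. Keeping it arbitrary allows
  the induction hypotheses to be used inside the joined tree, for \<open>s\<close> at its root and
  for \<open>t\<close> after rerooting at the child.\<close>

lemma path_le:
  "w \<in> cone \<Longrightarrow> inner w (br (path_shape (edges t))) \<le> inner w (br t)"
proof (induction t arbitrary: w)
  case (Join t s)
  let ?a = "edges t" and ?p = "br (path_shape (edges s))"
  have p: "?p \<in> cone" by (rule br_cone)
  \<comment> \<open>The path is cut \<open>Suc ?a\<close> edges away from the root. Its remaining
    \<open>edges s\<close> edges then move to the root, leaving one path in the place of
    \<open>t\<close> and one in the place of \<open>s\<close>.\<close>
  have "inner w (br (path_shape (edges (Join t s)))) = inner w ((K ^^ Suc ?a) ?p)"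
    by (simp add: br_path_shape funpow_add)
  also have "\<dots> \<le> inner (\<lambda>i. w i * ?p i) ((K ^^ Suc ?a) (\<lambda>_. 1))"
    using Join.prems p by (rule shift_le)
  also have "\<dots> = inner (K (\<lambda>i. w i * ?p i)) (br (path_shape ?a))"
    by (simp add: inner_K br_path_shape)
  also have "\<dots> \<le> inner (K (\<lambda>i. w i * ?p i)) (br t)"
    using Join p by (intro Join.IH K_cone mult_cone)
  also have "\<dots> = inner (\<lambda>i. w i * K (br t) i) ?p"
    by (simp add: inner_mult_K)
  also have "\<dots> \<le> inner (\<lambda>i. w i * K (br t) i) (br s)"
    using Join.prems by (intro Join.IH mult_cone K_cone br_cone)
  also have "\<dots> = inner w (br (Join t s))"
    by (rule inner_br_Join[symmetric])
  finally show ?case .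
qed simp

text \<open>The reverse order of steps: \<open>s\<close> and \<open>t\<close> first become stars,
  which are then merged into one.\<close>

lemma le_star:
  "w \<in> cone \<Longrightarrow> inner w (br t) \<le> inner w (br (star_shape (edges t)))"
proof (induction t arbitrary: w)
  case (Join t s)
  let ?q = "br (star_shape (edges t))" and ?p = "br (star_shape (edges s))"
  have p: "?p \<in> cone" and q: "?q \<in> cone" by (rule br_cone)+
  have "inner w (br (Join t s)) = inner (\<lambda>i. w i * K (br t) i) (br s)"
    by (rule inner_br_Join)
  also have "\<dots> \<le> inner (\<lambda>i. w i * K (br t) i) ?p"
    using Join.prems by (intro Join.IH mult_cone K_cone br_cone)
  also have "\<dots> = inner (K (\<lambda>i. w i * ?p i)) (br t)"
    by (simp add: inner_mult_K)
  also have "\<dots> \<le> inner (K (\<lambda>i. w i * ?p i)) ?q"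
    using Join p by (intro Join.IH K_cone mult_cone)
  also have "\<dots> = inner (\<lambda>i. w i * ?p i) ((K ^^ 1) ?q)"
    by (simp add: inner_K)
  \<comment> \<open>The leaves at the child move across the single edge to the root, and the child
    itself becomes a leaf.\<close>
  also have "\<dots> \<le> inner (\<lambda>i. (w i * ?p i) * ?q i) ((K ^^ 1) (\<lambda>_. 1))"
    using Join.prems p q by (intro shift_le mult_cone)
  also have "\<dots> = inner w (br (star_shape (edges (Join t s))))"
    by (simp add: br_star_shape inner_def power_add ac_simps)
  finally show ?case .
qed simp

end

section \<open>Partition functions of rooted trees\<close>

inductive rooted_tree :: "'v set \<Rightarrow> ('v \<times> 'v) set \<Rightarrow> 'v \<Rightarrow> shape \<Rightarrow> bool" where
  single: "rooted_tree {r} {} r Leaf"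
| join: "\<lbrakk>rooted_tree V E r s; rooted_tree W F c t; V \<inter> W = {}\<rbrakk>
    \<Longrightarrow> rooted_tree (V \<union> W) (E \<union> F \<union> {(r, c), (c, r)}) r (Join t s)"

lemma rooted_tree_wf:
  "rooted_tree V E r t \<Longrightarrow> finite V \<and> r \<in> V \<and> E \<subseteq> V \<times> V \<and> card V = Suc (edges t)"
  by (induction rule: rooted_tree.induct) (auto simp: card_Un_disjoint)

text \<open>Vertices are grouped by colour. The product over vertices is the form that splits over
  disjoint vertex sets.\<close>

lemma partition_function_conv_prod:
  assumes "finite (pverts G)" "finite (pverts H)"
  shows "partition_function act G H = (\<Sum>f\<in>Hom G H. \<Prod>v\<in>pverts G. act (f v))"
  unfolding partition_function_def
proof (rule sum.cong[OF refl])
  fix f assume "f \<in> Hom G H"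
  then have "f ` pverts G \<subseteq> pverts H" by (auto simp: Hom_def)
  then have "(\<Prod>v\<in>pverts G. act (f v)) = (\<Prod>i\<in>pverts H. \<Prod>v\<in>{u \<in> pverts G. f u = i}. act (f v))"
    using assms by (intro prod.group[symmetric])
  also have "\<dots> = (\<Prod>i\<in>pverts H. act i ^ card {u \<in> pverts G. f u = i})"
    by (intro prod.cong refl) simp
  finally show "(\<Prod>i\<in>pverts H. act i ^ card {u \<in> pverts G. f u = i}) = (\<Prod>v\<in>pverts G. act (f v))"
    by simp
qed

section \<open>Factorisation of colouring sums along an edge\<close>

context weighted_target
begin

abbreviation homs :: "'v set \<Rightarrow> ('v \<times> 'v) set \<Rightarrow> ('v \<Rightarrow> 'h) set" where
  "homs V E \<equiv> Hom \<lparr>pverts = V, parcs = E\<rparr> H"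

lemma finite_homs: "finite V \<Longrightarrow> finite (homs V E)"
  by (rule finite_subset[of _ "V \<rightarrow>\<^sub>E pverts H"]) (auto simp: Hom_def finite_colours intro: finite_PiE)

lemma homsI:
  "f \<in> V \<rightarrow>\<^sub>E pverts H \<Longrightarrow> (\<And>x y. (x, y) \<in> E \<Longrightarrow> (f x, f y) \<in> parcs H) \<Longrightarrow> f \<in> homs V E"
  by (auto simp: Hom_def)

text \<open>Restriction and gluing match colourings of the union with pairs. Only the new edge
  couples the parts, and once \<open>r\<close> has colour \<open>i\<close> it constrains
  \<open>g c\<close> alone.\<close>

lemma sum_homs_join:
  assumes "finite V" "finite W" "V \<inter> W = {}" "E \<subseteq> V \<times> V" "F \<subseteq> W \<times> W" "r \<in> V" "c \<in> W"
  shows "(\<Sum>f\<in>{f \<in> homs (V \<union> W) (E \<union> F \<union> {(r, c), (c, r)}). f r = i}. \<Prod>v\<in>V \<union> W. act (f v)) =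
    (\<Sum>f\<in>{f \<in> homs V E. f r = i}. \<Prod>v\<in>V. act (f v)) *
    (\<Sum>g\<in>{g \<in> homs W F. (i, g c) \<in> parcs H}. \<Prod>v\<in>W. act (g v))"
    (is "sum _ ?L = sum ?a ?A * sum ?b ?B")
proof -
  have disj: "x \<notin> V" if "x \<in> W" for x using that assms(3) by auto
  \<comment> \<open>Off \<open>V\<close> the glued map follows \<open>g\<close>, hence it is
    \<open>undefined\<close> outside \<open>V \<union> W\<close>, as extensionality demands.\<close>
  let ?j = "\<lambda>(f, g) x. if x \<in> V then f x else g x"
  have "(\<Sum>f\<in>?L. \<Prod>v\<in>V \<union> W. act (f v)) = (\<Sum>(f, g)\<in>?A \<times> ?B. ?a f * ?b g)"
  proof (rule sum.reindex_bij_witness[of _ ?j "\<lambda>f. (restrict f V, restrict f W)"])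
    fix f assume f: "f \<in> ?L"
    show "?j (restrict f V, restrict f W) = f"
      using f by (auto simp: Hom_def fun_eq_iff PiE_def extensional_def)
    have "(f x, f y) \<in> parcs H" if "(x, y) \<in> E \<union> F \<union> {(r, c), (c, r)}" for x y
      using f that unfolding Hom_def by auto
    moreover have "f \<in> V \<union> W \<rightarrow>\<^sub>E pverts H" "f r = i"
      using f by (auto simp: Hom_def)
    ultimately show "(restrict f V, restrict f W) \<in> ?A \<times> ?B"
      using assms(4-7) by (auto simp: Hom_def PiE_mem)
    show "(case (restrict f V, restrict f W) of (f, g) \<Rightarrow> ?a f * ?b g) = (\<Prod>v\<in>V \<union> W. act (f v))"
      using assms by (simp add: prod.union_disjoint)
  next
    fix p assume p: "p \<in> ?A \<times> ?B"
    obtain f g where [simp]: "p = (f, g)" by (cases p)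
    show "(restrict (?j p) V, restrict (?j p) W) = p"
      using p disj by (auto simp: Hom_def fun_eq_iff PiE_def extensional_def)
    have ext: "?j p \<in> V \<union> W \<rightarrow>\<^sub>E pverts H"
      using p by (auto simp: Hom_def PiE_def extensional_def)
    have "(?j p x, ?j p y) \<in> parcs H" if xy: "(x, y) \<in> E \<union> F \<union> {(r, c), (c, r)}" for x y
    proof -
      consider "(x, y) \<in> E" | "(x, y) \<in> F" | "(x, y) = (r, c)" | "(x, y) = (c, r)"
        using xy by blast
      then show ?thesis
        using p disj assms by cases (auto simp: Hom_def intro: sym_arcs)
    qed
    moreover have "?j p r = i" using p \<open>r \<in> V\<close> by simp
    ultimately show "?j p \<in> ?L"
      using ext by (intro CollectI conjI homsI)
  qed
  then show ?thesis by (simp add: sum_product sum.cartesian_product)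
qed

text \<open>With adjacency to a fixed colour as \<open>P\<close> this produces \<open>K\<close>;
  with the trivial \<open>P\<close> it produces the sum over root colours in
  \<open>inner\<close>.\<close>

lemma sum_homs_group:
  assumes "finite V" "c \<in> V"
  shows "(\<Sum>g\<in>{g \<in> homs V E. P (g c)}. h g) =
    (\<Sum>j\<in>pverts H. if P j then \<Sum>g\<in>{g \<in> homs V E. g c = j}. h g else (0::real))"
proof -
  have "(\<lambda>g. g c) ` {g \<in> homs V E. P (g c)} \<subseteq> pverts H"
    using assms by (auto simp: Hom_def)
  then have "(\<Sum>g\<in>{g \<in> homs V E. P (g c)}. h g) =
      (\<Sum>j\<in>pverts H. \<Sum>g\<in>{g \<in> {g \<in> homs V E. P (g c)}. g c = j}. h g)"
    using finite_homs[OF assms(1)] finite_colours by (intro sum.group[symmetric]) auto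
  also have "\<dots> = (\<Sum>j\<in>pverts H. if P j then \<Sum>g\<in>{g \<in> homs V E. g c = j}. h g else 0)"
    by (intro sum.cong refl) (auto intro!: sum.cong sum.neutral)
  finally show ?thesis .
qed

lemma sum_homs_rooted_tree:
  assumes "rooted_tree V E r t" "i \<in> pverts H"
  shows "(\<Sum>f\<in>{f \<in> homs V E. f r = i}. \<Prod>v\<in>V. act (f v)) = act i * br t i"
  using assms
proof (induction arbitrary: i rule: rooted_tree.induct)
  case (single r)
  then have "{f \<in> homs {r} {}. f r = i} = {\<lambda>x. if x = r then i else undefined}"
    by (auto simp: Hom_def PiE_def extensional_def fun_eq_iff)
  then show ?case by simp
next
  case (join V E r s W F c t)
  then show ?case
    using rooted_tree_wf[OF join(1)] rooted_tree_wf[OF join(2)]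
    by (subst sum_homs_join)
      (auto simp: sum_homs_group[where P = "\<lambda>j. (i, j) \<in> parcs H"] K_def intro!: sum.cong)
qed

lemma partition_function_rooted_tree:
  assumes "rooted_tree (pverts G) (parcs G) r t"
  shows "partition_function act G H = inner (\<lambda>_. 1) (br t)"
proof -
  have G: "finite (pverts G)" "r \<in> pverts G" using rooted_tree_wf[OF assms] by auto
  have "partition_function act G H = (\<Sum>f\<in>{f \<in> homs (pverts G) (parcs G). True}. \<Prod>v\<in>pverts G. act (f v))"
    using G by (simp add: partition_function_conv_prod finite_colours Hom_def)
  also have "\<dots> = inner (\<lambda>_. 1) (br t)"
    using G sum_homs_rooted_tree[OF assms]
    by (subst sum_homs_group[where c = r and P = "\<lambda>_. True"]) (auto simp: inner_def)
  finally show ?thesis .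
qed

end

text \<open>The root is the last vertex, so that each further vertex becomes a new root above the
  old one.\<close>

lemma rooted_tree_path_graph:
  "rooted_tree (pverts (path_graph (Suc m))) (parcs (path_graph (Suc m))) m (path_shape m)"
proof (induction m)
  case 0
  have "pverts (path_graph (Suc 0)) = {0}" "parcs (path_graph (Suc 0)) = {}"
    by (auto simp: path_graph_def)
  then show ?case by (simp add: rooted_tree.single)
next
  case (Suc m)
  have "pverts (path_graph (Suc (Suc m))) = {Suc m} \<union> pverts (path_graph (Suc m))"
    "parcs (path_graph (Suc (Suc m))) =
      {} \<union> parcs (path_graph (Suc m)) \<union> {(Suc m, m), (m, Suc m)}"
    by (auto simp: path_graph_def)
  moreover have "{Suc m} \<inter> pverts (path_graph (Suc m)) = {}"
    by (auto simp: path_graph_def)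
  ultimately show ?case
    using rooted_tree.join[OF rooted_tree.single Suc] by simp
qed

lemma rooted_tree_star_graph:
  "rooted_tree (pverts (star_graph (Suc m))) (parcs (star_graph (Suc m))) 0 (star_shape m)"
proof (induction m)
  case 0
  have "pverts (star_graph (Suc 0)) = {0}" "parcs (star_graph (Suc 0)) = {}"
    by (auto simp: star_graph_def)
  then show ?case by (simp add: rooted_tree.single)
next
  case (Suc m)
  have "pverts (star_graph (Suc (Suc m))) = pverts (star_graph (Suc m)) \<union> {Suc m}"
    "parcs (star_graph (Suc (Suc m))) =
      parcs (star_graph (Suc m)) \<union> {} \<union> {(0, Suc m), (Suc m, 0)}"
    by (auto simp: star_graph_def)
  moreover have "pverts (star_graph (Suc m)) \<inter> {Suc m} = {}"
    by (auto simp: star_graph_def)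
  ultimately show ?case
    using rooted_tree.join[OF Suc rooted_tree.single] by simp
qed

section \<open>Undirected trees as rooted trees\<close>

text \<open>By induction the leaf goes into whichever of the two joined parts contains
  \<open>u\<close>; the root stays the same.\<close>

lemma rooted_tree_add_leaf:
  assumes "rooted_tree V E r t" "u \<in> V" "z \<notin> V"
  shows "\<exists>t'. rooted_tree (insert z V) (E \<union> {(u, z), (z, u)}) r t'"
  using assms
proof (induction rule: rooted_tree.induct)
  case (single r)
  then show ?case
    using rooted_tree.join[OF rooted_tree.single[of r] rooted_tree.single[of z]]
    by (auto simp: insert_commute)
next
  case (join V E r s W F c t)
  show ?case
  proof (cases "u \<in> V")
    case True
    then obtain s' where "rooted_tree (insert z V) (E \<union> {(u, z), (z, u)}) r s'"
      using join by auto
    from rooted_tree.join[OF this join(2)] join(3,7) show ?thesis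
      by (auto simp: Un_ac insert_commute)
  next
    case False
    then obtain t' where "rooted_tree (insert z W) (F \<union> {(u, z), (z, u)}) c t'"
      using join by auto
    from rooted_tree.join[OF join(1) this] join(3,7) show ?thesis
      by (auto simp: Un_ac insert_commute)
  qed
qed

section \<open>Connectivity and walks inside rooted trees\<close>

lemma rooted_tree_sym: "rooted_tree V E r t \<Longrightarrow> sym E"
  by (induction rule: rooted_tree.induct) (auto simp: sym_def)

lemma rooted_tree_root_reaches: "rooted_tree V E r t \<Longrightarrow> a \<in> V \<Longrightarrow> (r, a) \<in> E\<^sup>*"
proof (induction rule: rooted_tree.induct)
  case (join V E r s W F c t)
  let ?E = "E \<union> F \<union> {(r, c), (c, r)}"
  have "E\<^sup>* \<subseteq> ?E\<^sup>*" "F\<^sup>* \<subseteq> ?E\<^sup>*" using rtrancl_mono[of E ?E] rtrancl_mono[of F ?E] by blast+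
  moreover have "(r, c) \<in> ?E" by simp
  ultimately show ?case
    using join.IH join.prems by (meson UnE converse_rtrancl_into_rtrancl subsetD)
qed simp

lemma rooted_tree_connected:
  assumes "rooted_tree V E r t" "a \<in> V" "b \<in> V"
  shows "(a, b) \<in> E\<^sup>*"
  using rooted_tree_root_reaches[OF assms(1)] assms(2,3) rooted_tree_sym[OF assms(1)]
  by (meson rtrancl_trans sym_rtrancl symD)

text \<open>Confining the walk to \<open>E\<close> later keeps it away from a vertex outside the
  subtree.\<close>

lemma (in pair_wf_digraph) rtrancl_imp_awalk:
  assumes "(a, b) \<in> E\<^sup>*" "E \<subseteq> parcs G" "a \<in> pverts G"
  shows "\<exists>p. awalk a p b \<and> set p \<subseteq> E"
  using assms
proof (induction rule: converse_rtrancl_induct)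
  case base
  then show ?case by (intro exI[of _ "[]"]) (simp add: awalk_Nil_iff)
next
  case (step y z)
  then obtain p where "awalk z p b" "set p \<subseteq> E" by (auto dest: in_arcsD2)
  with step show ?case
    by (intro exI[of _ "(y, z) # p"]) (auto simp: awalk_Cons_iff)
qed

lemma (in pair_wf_digraph) awalk_verts_arcs:
  "awalk a p b \<Longrightarrow> set (awalk_verts a p) \<subseteq> insert a (snd ` set p)"
  by (induction p arbitrary: a) (auto simp: awalk_Cons_iff)

text \<open>Two different neighbours of \<open>z\<close> would be joined by a simple path inside
  \<open>W\<close>, which closes up through \<open>z\<close> to a forbidden cycle.\<close>

lemma (in pair_graph) unique_neighbour_in_subtree:
  assumes acyc: "\<not> (\<exists>p. cycle p \<and> 3 \<le> length p)"
    and W: "rooted_tree W E r t" "E \<subseteq> parcs G"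
    and z: "z \<notin> W" "u \<in> W" "u' \<in> W" "(u, z) \<in> parcs G" "(u', z) \<in> parcs G"
  shows "u = u'"
proof (rule ccontr)
  assume "u \<noteq> u'"
  have EW: "E \<subseteq> W \<times> W" using rooted_tree_wf[OF W(1)] by simp
  obtain q where q: "awalk u q u'" "set q \<subseteq> E"
    using rtrancl_imp_awalk[OF rooted_tree_connected[OF W(1) z(2,3)] W(2)] z(4)
    by (auto dest: in_arcsD1)
  define p where "p = awalk_to_apath q"
  have p: "apath u p u'" "set p \<subseteq> E"
    using apath_awalk_to_apath[OF q(1)] awalk_to_apath_subset[OF q(1)] q(2) by (auto simp: p_def)
  then have aw: "awalk u p u'" and dist: "distinct (awalk_verts u p)" by (auto simp: apath_def)
  have "z \<notin> set (awalk_verts u p)"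
    using awalk_verts_arcs[OF aw] p(2) EW z(1,2) by fastforce
  have "p \<noteq> []" using aw \<open>u \<noteq> u'\<close> by (auto simp: awalk_Nil_iff)
  have "(z, u) \<in> parcs G" using z(4) by (rule arcs_symmetric)
  then have c: "awalk z ((z, u) # p @ [(u', z)]) z"
    using aw z(5) by (auto simp: awalk_simps dest: in_arcsD1 in_arcsD2)
  have "awalk u (p @ [(u', z)]) z"
    using c aw by (simp add: awalk_Cons_iff)
  then have "awalk_verts u (p @ [(u', z)]) = awalk_verts u p @ [z]"
    by (subst awalk_verts_append) auto
  then have "cycle ((z, u) # p @ [(u', z)])"
    unfolding cycle_def using c dist \<open>z \<notin> set (awalk_verts u p)\<close> by (intro exI[of _ z]) simp
  \<comment> \<open>Since \<open>u \<noteq> u'\<close>, at least one arc lies between the two arcs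
    at \<open>z\<close>; this is no mere back-and-forth along one edge.\<close>
  moreover have "3 \<le> length ((z, u) # p @ [(u', z)])"
    using \<open>p \<noteq> []\<close> by (cases p) auto
  ultimately show False using acyc by blast
qed

text \<open>Take a largest set of vertices that induces a rooted tree. An arc leaving it would end in a
  vertex with just one neighbour in the set, by acyclicity, and so this vertex could be added as a leaf.\<close>

lemma undirected_tree_imp_rooted_tree:
  assumes "undirected_tree T"
  obtains r t where "rooted_tree (pverts T) (parcs T) r t"
proof -
  interpret pair_graph T using assms by (simp add: undirected_tree_def)
  have acyc: "\<not> (\<exists>p. cycle p \<and> 3 \<le> length p)"
    using assms by (simp add: undirected_tree_def)
  have conn: "strongly_connected (mk_symmetric (with_proj T))"
    using assms by (simp add: undirected_tree_def connected_def)
  let ?P = "\<lambda>W. W \<subseteq> pverts T \<and> (\<exists>r t. rooted_tree W (parcs T \<inter> W \<times> W) r t)"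
  have "pverts T \<noteq> {}" using conn by (auto simp: strongly_connected_def)
  then obtain x where x: "x \<in> pverts T" by blast
  have "parcs T \<inter> {x} \<times> {x} = {}" using no_loops' by auto
  then have Px: "?P {x}" using x rooted_tree.single[of x] by auto
  have "\<forall>X. ?P X \<longrightarrow> card X < Suc (card (pverts T))"
    using pair_finite_verts by (simp add: card_mono less_Suc_eq_le)
  from ex_has_greatest_nat[of ?P "{x}" card, OF Px this]
  obtain W r t where W: "W \<subseteq> pverts T" "rooted_tree W (parcs T \<inter> W \<times> W) r t"
    and max: "\<And>X. ?P X \<Longrightarrow> card X \<le> card W" by blast
  have wf: "finite W" "r \<in> W" using rooted_tree_wf[OF W(2)] by auto
  have closed: "z \<in> W" if "u \<in> W" "(u, z) \<in> parcs T" for u z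
  proof (rule ccontr)
    assume "z \<notin> W"
    have uniq: "u' = u" if "u' \<in> W" "(u', z) \<in> parcs T" for u'
      using unique_neighbour_in_subtree[OF acyc W(2) _ \<open>z \<notin> W\<close> that(1) \<open>u \<in> W\<close> that(2) \<open>(u, z) \<in> parcs T\<close>]
      by simp
    obtain t' where t': "rooted_tree (insert z W) (parcs T \<inter> W \<times> W \<union> {(u, z), (z, u)}) r t'"
      using rooted_tree_add_leaf[OF W(2) \<open>u \<in> W\<close> \<open>z \<notin> W\<close>] by blast
    have "u' = u" if "u' \<in> W" "(z, u') \<in> parcs T" for u'
      using uniq that arcs_symmetric by blast
    moreover have "(z, u) \<in> parcs T" "(z, z) \<notin> parcs T"
      using arcs_symmetric[OF \<open>(u, z) \<in> parcs T\<close>] no_loops' by blast+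
    \<comment> \<open>The enlarged set again carries all arcs that \<open>T\<close> induces on it,
      contradicting the maximality of \<open>W\<close>.\<close>
    ultimately have "parcs T \<inter> insert z W \<times> insert z W = parcs T \<inter> W \<times> W \<union> {(u, z), (z, u)}"
      using uniq \<open>u \<in> W\<close> \<open>(u, z) \<in> parcs T\<close> by blast
    then have "?P (insert z W)"
      using t' W(1) in_arcsD2[OF \<open>(u, z) \<in> parcs T\<close>] by auto
    from max[OF this] show False using \<open>z \<notin> W\<close> wf by simp
  qed
  \<comment> \<open>Closed under arcs, \<open>W\<close> contains all that is reachable from
    \<open>r\<close>. Connectedness speaks of the symmetric closure, which has the same reachability
    as the symmetric \<open>T\<close>.\<close>
  have "z \<in> W" if "z \<in> pverts T" for z
  proof -
    have "r \<rightarrow>\<^sup>*\<^bsub>mk_symmetric (with_proj T)\<^esub> z"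
      using conn that W(1) wf(2) by (auto simp: strongly_connected_def)
    then have "r \<rightarrow>\<^sup>*\<^bsub>with_proj T\<^esub> z"
      using reachable_mk_symmetric_eq[OF pair_sym_arcs] by simp
    then show ?thesis
      unfolding reachable_def by (induction rule: rtrancl_on_induct) (use wf closed in auto)
  qed
  then have "W = pverts T" using W(1) by auto
  moreover from this have "parcs T \<inter> W \<times> W = parcs T"
    by (auto dest: in_arcsD1 in_arcsD2)
  ultimately show ?thesis using W(2) that by simp
qed

section \<open>The three models\<close>

context ordered_target
begin

lemma partition_function_tree_bounds:
  assumes "n \<ge> 1" "T \<in> trees n"
  shows "partition_function act (path_graph n) H \<le> partition_function act T H"
    and "partition_function act T H \<le> partition_function act (star_graph n) H"
proof -
  obtain r t where rt: "rooted_tree (pverts T) (parcs T) r t"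
    using assms undirected_tree_imp_rooted_tree by (auto simp: trees_def)
  have n: "n = Suc (edges t)"
    using rooted_tree_wf[OF rt] assms by (simp add: trees_def)
  note Z = partition_function_rooted_tree
  show "partition_function act (path_graph n) H \<le> partition_function act T H"
    unfolding n Z[OF rt] Z[OF rooted_tree_path_graph] by (rule path_le[OF one_cone])
  show "partition_function act T H \<le> partition_function act (star_graph n) H"
    unfolding n Z[OF rt] Z[OF rooted_tree_star_graph] by (rule le_star[OF one_cone])
qed

end

text \<open>The neighbourhoods are nested and grow as the colour decreases, hence the reversed
  order; nonnegative terms are compared one by one.\<close>

lemma ordered_target_cap:
  assumes "lam > 0"
  shows "ordered_target (H_cap C) (\<lambda>i. lam ^ i) (\<ge>)"
proof -
  interpret weighted_target "H_cap C" "\<lambda>i. lam ^ i"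
    using assms by unfold_locales (auto simp: H_cap_def add.commute)
  show ?thesis
  proof unfold_locales
    fix u :: "nat \<Rightarrow> real" and i j :: nat
    assume "\<And>i. i \<in> pverts (H_cap C) \<Longrightarrow> 0 \<le> u i" "i \<ge> j"
    then show "K u i \<le> K u j"
      unfolding K_def using assms by (intro sum_mono) (auto simp: H_cap_def)
  qed auto
qed

text \<open>The centre is on top, as it sees every colour. A colour \<open>i \<noteq> 0\<close> sees
  only \<open>0\<close> and itself, so \<open>K u i = u 0 + lam i * u i\<close> and ordering by
  activity makes this monotone.\<close>

lemma ordered_target_WR:
  fixes lam :: "nat \<Rightarrow> real"
  assumes "\<forall>i\<in>{1..k}. lam i > 0"
  shows "ordered_target (H_WR k) (lam(0 := 1)) (\<lambda>i j. j = 0 \<or> i \<noteq> 0 \<and> lam i \<le> lam j)"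
proof -
  let ?act = "lam(0 := 1)"
  have pos: "0 \<le> ?act i" if "i \<le> k" for i using assms that by (cases "i = 0") (auto intro: less_imp_le)
  interpret weighted_target "H_WR k" ?act
    using pos by unfold_locales (auto simp: H_WR_def)
  have K0: "K u 0 = (\<Sum>j\<in>{0..k}. ?act j * u j)" for u
    unfolding K_def by (intro sum.cong) (auto simp: H_WR_def)
  have K: "K u i = (\<Sum>j\<in>{0, i}. ?act j * u j)" if "i \<le> k" "i \<noteq> 0" for u i
    unfolding K_def using that by (intro sum.mono_neutral_cong_right) (auto simp: H_WR_def)
  show ?thesis
  proof unfold_locales
    fix u :: "nat \<Rightarrow> real" and i j :: nat
    assume u: "\<And>i. i \<in> pverts (H_WR k) \<Longrightarrow> 0 \<le> u i"
      "\<And>i j. i \<in> pverts (H_WR k) \<Longrightarrow> j \<in> pverts (H_WR k) \<Longrightarrow>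
        j = 0 \<or> i \<noteq> 0 \<and> lam i \<le> lam j \<Longrightarrow> u i \<le> u j"
      and ij: "i \<in> pverts (H_WR k)" "j \<in> pverts (H_WR k)" "j = 0 \<or> i \<noteq> 0 \<and> lam i \<le> lam j"
    have le: "i \<le> k" "j \<le> k" using ij by (auto simp: H_WR_def)
    have nn: "0 \<le> u x" if "x \<le> k" for x using u(1) that by (simp add: H_WR_def)
    consider "i = 0" "j = 0" | "i \<noteq> 0" "j = 0" | "i \<noteq> 0" "j \<noteq> 0" "lam i \<le> lam j"
      using ij(3) by blast
    then show "K u i \<le> K u j"
    proof cases
      case 2
      have "K u i \<le> (\<Sum>x\<in>{0..k}. ?act x * u x)"
        unfolding K[OF le(1) 2(1)]
      proof (rule sum_mono2)
        show "0 \<le> ?act x * u x" if "x \<in> {0..k} - {0, i}" for x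
          using that by (intro mult_nonneg_nonneg pos nn) auto
      qed (use le in auto)
      then show ?thesis using 2 by (simp add: K0)
    next
      case 3
      then have "lam i * u i \<le> lam j * u j"
        using u(2)[OF ij] nn[OF le(1)] pos[OF le(2)] by (intro mult_mono) auto
      then show ?thesis using 3 le by (simp add: K)
    qed simp
  qed auto
qed

lemma partition_function_ind:
  "partition_function (\<lambda>i. [1, lam] ! i) G H_ind = partition_function (\<lambda>i. lam ^ i) G (H_cap 1)"
proof -
  have H: "H_ind = H_cap 1" by (auto simp: H_ind_def H_cap_def)
  \<comment> \<open>Agreement is claimed on the colours \<open>0\<close> and \<open>1\<close> only:
    beyond them the list index is out of range.\<close>
  have "[1, lam] ! i = lam ^ i" if "i \<in> pverts (H_cap 1)" for i
    using that by (auto simp: H_cap_def le_Suc_eq)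
  then show ?thesis unfolding partition_function_def H by simp
qed

theorem theorem4p19:
  fixes n :: nat and T :: "'a pair_pre_digraph"
  assumes "n \<ge> 1" and "T \<in> trees n"
  shows "(\<forall>lam::real. lam > 0 \<longrightarrow>
           partition_function (\<lambda>i. [1, lam] ! i) (path_graph n) H_ind \<le> partition_function (\<lambda>i. [1, lam] ! i) T H_ind \<and>
           partition_function (\<lambda>i. [1, lam] ! i) T H_ind \<le> partition_function (\<lambda>i. [1, lam] ! i) (star_graph n) H_ind) \<and>
         (\<forall>(k::nat) (lam :: nat \<Rightarrow> real). k \<ge> 1 \<longrightarrow> (\<forall>i\<in>{1..k}. lam i > 0) \<longrightarrow>
           partition_function (lam(0 := 1)) (path_graph n) (H_WR k) \<le> partition_function (lam(0 := 1)) T (H_WR k) \<and>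
           partition_function (lam(0 := 1)) T (H_WR k) \<le> partition_function (lam(0 := 1)) (star_graph n) (H_WR k)) \<and>
         (\<forall>(C::nat) (lam::real). C \<ge> 1 \<longrightarrow> lam > 0 \<longrightarrow>
           partition_function (\<lambda>i. lam ^ i) (path_graph n) (H_cap C) \<le> partition_function (\<lambda>i. lam ^ i) T (H_cap C) \<and>
           partition_function (\<lambda>i. lam ^ i) T (H_cap C) \<le> partition_function (\<lambda>i. lam ^ i) (star_graph n) (H_cap C))"
  unfolding partition_function_ind
  using ordered_target.partition_function_tree_bounds[OF ordered_target_cap assms]
    ordered_target.partition_function_tree_bounds[OF ordered_target_WR assms]
  by blast

end
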